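(* Let $(\mathbf{A},X)$ be an $(\mathcal{F},\star)$-axial algebra over a field $F$, $V$ a vector space over $F$ and $\theta\colon \mathbf{A}\times\mathbf{A}\to V$ a symmetric bilinear map such that, for a basis $\{e_\gamma\}_{\gamma\in\Gamma}$ of $V$, the classes $\{[\theta_\gamma]\}_{\gamma\in\Gamma}$ are linearly independent. Let $\{X^i\}_{i\in I}$ be the family of minimal sets of $(\mathcal{F},\star)$-axes generating $\mathbf{A}$, with $X^i=\{a^i_1,\dots,a^i_{r^i}\}$. (a) Let $i\in I$, and suppose that the representative $\theta$ of its class modulo $\{\delta f\}$ has been chosen so that $\theta(a^i_j,a^i_j)=0$ for $j=1,\dots,r^i$. Then the pair $(\mathbf{A}_\theta,X^i)$ is $(\mathcal{F}\cup\{0\},\odot^i)$-axial for some fusion law $(\mathcal{F}\cup\{0\},\odot^i)$ containing $(\mathcal{F},\star)$ if and only if $\ker L_{a^i_j}\subseteq\theta_{a^i_j}^\perp$ for all $j=1,\dots,r^i$. Furthermore, we can take $\odot^i=\star$ if and only if $\theta\in Z(\mathbf{A},V;X^i)$. (b) Define $Y=\{a+\theta(a,a)\mid a\in X\}\subseteq \mathbf{A}_\theta$ (here $\theta$ is not assumed to be normalised). For every $Y'\subseteq Y$ such that there exists $i\in I$ with $X^i\subseteq P(Y')$, the pair $(\mathbf{A}_\theta,Y')$ is $(\mathcal{F}\cup\{0\},\odot)$-axial for some fusion law $(\mathcal{F}\cup\{0\},\odot)$ containing $(\mathcal{F},\star)$ if and only if $\ker L_a\subseteq\theta_a^\perp$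 for all $a\in P(Y')$. We can take $\odot=\star$ if and only if $\theta\in Z(\mathbf{A},V;P(Y'))$.
   Context: Algebras over the field $F$ are not necessarily associative, and algebras and vector spaces may have arbitrary dimension. A fusion law over $F$ is a pair $(\mathcal{F},\star)$ with $\mathcal{F}\subseteq F$ and $\star\colon\mathcal{F}\times\mathcal{F}\to 2^{\mathcal{F}}$ symmetric. $(\mathcal{F},\star)$ is contained in $(\mathcal{G},\odot)$ if $\mathcal{F}\subseteq\mathcal{G}$ and $\lambda\star\mu\subseteq\lambda\odot\mu$ for all $\lambda,\mu\in\mathcal{F}$. The law $(\mathcal{F}\cup\{0\},\star)$ is $(\mathcal{F},\star)$ if $0\in\mathcal{F}$, and otherwise extends $\star$ by $0\star\mu=\mu\star 0=\emptyset$ for all $\mu$; "$\odot=\star$" refers to this law. For a commutative algebra $\mathbf{A}$ and $x\in\mathbf{A}$: $L_x\colon y\mapsto xy$; $\mathrm{Spec}(x)$ is the set of eigenvalues of $L_x$; $\mathbf{A}^x_\lambda$ is the $\lambda$-eigenspace of $L_x$ ($0$ if $\lambda\notin\mathrm{Spec}(x)$); $\mathbf{A}^x_S=\bigoplus_{\lambda\in S}\mathbf{A}^x_\lambda$, with $\mathbf{A}^x_\emptyset=0$. The element $x$ is semisimple if every element of $\mathbf{A}$ lies in a finite-dimensional $L_x$-stable subspace and $L_x$ restricts to a diagonalisable map on every finite-dimensional $L_x$-stable subspace. An $(\mathcal{F},\star)$-axis is a nonzero semisimple idempotent $a$ with $\mathrm{Spec}(a)\subseteq\mathcal{F}$ and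 $\mathbf{A}^a_\lambda\mathbf{A}^a_\mu\subseteq\mathbf{A}^a_{\lambda\star\mu}$ for all $\lambda,\mu\in\mathrm{Spec}(a)$. An $(\mathcal{F},\star)$-axial algebra is a pair $(\mathbf{A},X)$ with $\mathbf{A}$ a commutative algebra and $X$ a finite set of $(\mathcal{F},\star)$-axes generating $\mathbf{A}$ as an algebra. Minimal generating sets are minimal with respect to inclusion. For a bilinear map $\theta\colon\mathbf{A}\times\mathbf{A}\to V$, the central extension $\mathbf{A}_\theta$ is the vector space $\mathbf{A}\dotplus V$ with product $[x+v,y+w]_\theta=xy+\theta(x,y)$; $P\colon\mathbf{A}_\theta\to\mathbf{A}$ is the projection $x+v\mapsto x$; $\theta_x^\perp=\{y\in\mathbf{A}\mid\theta(x,y)=0\}$. For a linear map $f\colon\mathbf{A}\to V$, $\delta f(x,y)=f(xy)$; $[\theta]$ is the class of $\theta$ in bilinear maps modulo $\{\delta f\mid f \text{ linear}\}$. For a basis $\{e_\gamma\}_{\gamma\in\Gamma}$ of $V$, write $\theta(x,y)=\sum_\gamma\theta_\gamma(x,y)e_\gamma$ with $\theta_\gamma\colon\mathbf{A}\times\mathbf{A}\to F$ bilinear; $[\theta_\gamma]$ is taken modulo the maps $\delta f$, $f\colon\mathbf{A}\to F$ linear. Cocycles: for a set $X'$ of $(\mathcal{F},\star)$-axes of $\mathbf{A}$, $Z(\mathbf{A},V;X')$ is the vector space of symmetric bilinear maps $\theta\colon\mathbf{A}\times\mathbf{A}\to V$ such that for every $a\in X'$: (1) $\ker L_a\subseteq\theta_a^\perp$;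 and (2) for all $\lambda,\mu\in\mathrm{Spec}(a)$ with $0\notin\lambda\star\mu$ and all $x\in\mathbf{A}^a_\lambda$, $y\in\mathbf{A}^a_\mu$, one has $\theta(x,y)=\sum_{\nu\in\lambda\star\mu}\nu^{-1}\theta(a,z_\nu)$, where $xy=\sum_{\nu\in\lambda\star\mu}z_\nu$ with $z_\nu\in\mathbf{A}^a_\nu$.
   Formalization: The classes [θ_γ] are assumed linearly independent for every basis of V, not just for one; for finite-dimensional V this is the same, while for infinite-dimensional V independence for a single basis does not suffice and the claim fails. *)

theory Defs
  imports "HOL-Analysis.Product_Vector"
begin

text \<open>
  The algebra \<open>A\<close> is a whole type \<open>'a\<close>, with scalar multiplication \<open>s\<close> and product \<open>m\<close>.
\<close>

definition bilinear_map ::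
  "('f::field \<Rightarrow> 'a::ab_group_add \<Rightarrow> 'a) \<Rightarrow> ('f \<Rightarrow> 'b::ab_group_add \<Rightarrow> 'b)
    \<Rightarrow> ('f \<Rightarrow> 'c::ab_group_add \<Rightarrow> 'c) \<Rightarrow> ('a \<Rightarrow> 'b \<Rightarrow> 'c) \<Rightarrow> bool" where
  "bilinear_map s1 s2 s3 \<beta> \<longleftrightarrow>
     (\<forall>x. Vector_Spaces.linear s2 s3 (\<beta> x)) \<and>
     (\<forall>y. Vector_Spaces.linear s1 s3 (\<lambda>x. \<beta> x y))"

locale comm_algebra = vector_space s
  for s :: "'f::field \<Rightarrow> 'a::ab_group_add \<Rightarrow> 'a" +
  fixes m :: "'a \<Rightarrow> 'a \<Rightarrow> 'a"
  assumes bilinear_mult: "bilinear_map s s s m"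
    and mult_commute: "m x y = m y x"

definition basis :: "('f::field \<Rightarrow> 'v::ab_group_add \<Rightarrow> 'v) \<Rightarrow> 'v set \<Rightarrow> bool" where
  "basis s E \<longleftrightarrow> \<not> module.dependent s E \<and> module.span s E = UNIV"


section \<open>Fusion laws\<close>

text \<open>
  Only the values of \<open>star\<close> on pairs of elements of \<open>Fs\<close> are relevant.
\<close>

definition fusion_law :: "'f set \<Rightarrow> ('f \<Rightarrow> 'f \<Rightarrow> 'f set) \<Rightarrow> bool" where
  "fusion_law Fs star \<longleftrightarrow>
     (\<forall>l\<in>Fs. \<forall>u\<in>Fs. star l u \<subseteq> Fs \<and> star l u = star u l)"

definition fusion_contained ::
  "'f set \<Rightarrow> ('f \<Rightarrow> 'f \<Rightarrow> 'f set) \<Rightarrow> 'f set \<Rightarrow> ('f \<Rightarrow> 'f \<Rightarrow> 'f set) \<Rightarrow> bool" where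
  "fusion_contained Fs star Gs odot \<longleftrightarrow>
     Fs \<subseteq> Gs \<and> (\<forall>l\<in>Fs. \<forall>u\<in>Fs. star l u \<subseteq> odot l u)"

text \<open>
  The law on \<open>Fs \<union> {0}\<close> induced by \<open>(Fs, star)\<close>: it agrees with \<open>star\<close> on \<open>Fs\<close>, and the
  other pairs, which exist only if \<open>0 \<notin> Fs\<close>, are sent to \<open>{}\<close>.
\<close>

definition zero_ext :: "'f set \<Rightarrow> ('f \<Rightarrow> 'f \<Rightarrow> 'f set) \<Rightarrow> 'f \<Rightarrow> 'f \<Rightarrow> 'f set" where
  "zero_ext Fs star l u = (if l \<in> Fs \<and> u \<in> Fs then star l u else {})"


section \<open>Axes and axial algebras\<close>

definition eigenspace ::
  "('f::field \<Rightarrow> 'a::ab_group_add \<Rightarrow> 'a) \<Rightarrow> ('a \<Rightarrow> 'a \<Rightarrow> 'a) \<Rightarrow> 'a \<Rightarrow> 'f \<Rightarrow> 'a set" where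
  "eigenspace s m x l = {y. m x y = s l y}"

definition Spec ::
  "('f::field \<Rightarrow> 'a::ab_group_add \<Rightarrow> 'a) \<Rightarrow> ('a \<Rightarrow> 'a \<Rightarrow> 'a) \<Rightarrow> 'a \<Rightarrow> 'f set" where
  "Spec s m x = {l. \<exists>y. y \<noteq> 0 \<and> m x y = s l y}"

text \<open>
  The sum of the eigenspaces for \<open>l \<in> S\<close>; it is automatically direct.
\<close>

definition eigensum ::
  "('f::field \<Rightarrow> 'a::ab_group_add \<Rightarrow> 'a) \<Rightarrow> ('a \<Rightarrow> 'a \<Rightarrow> 'a) \<Rightarrow> 'a \<Rightarrow> 'f set \<Rightarrow> 'a set" where
  "eigensum s m x S = module.span s (\<Union>l\<in>S. eigenspace s m x l)"

definition fin_dim_stable ::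
  "('f::field \<Rightarrow> 'a::ab_group_add \<Rightarrow> 'a) \<Rightarrow> ('a \<Rightarrow> 'a \<Rightarrow> 'a) \<Rightarrow> 'a \<Rightarrow> 'a set \<Rightarrow> bool" where
  "fin_dim_stable s m x W \<longleftrightarrow>
     module.subspace s W \<and> (\<exists>B. finite B \<and> module.span s B = W) \<and> (\<forall>y\<in>W. m x y \<in> W)"

definition diagonalisable_on ::
  "('f::field \<Rightarrow> 'a::ab_group_add \<Rightarrow> 'a) \<Rightarrow> ('a \<Rightarrow> 'a \<Rightarrow> 'a) \<Rightarrow> 'a \<Rightarrow> 'a set \<Rightarrow> bool" where
  "diagonalisable_on s m x W \<longleftrightarrow>
     (\<exists>B. \<not> module.dependent s B \<and> module.span s B = W \<and> (\<forall>b\<in>B. \<exists>l. m x b = s l b))"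

definition semisimple ::
  "('f::field \<Rightarrow> 'a::ab_group_add \<Rightarrow> 'a) \<Rightarrow> ('a \<Rightarrow> 'a \<Rightarrow> 'a) \<Rightarrow> 'a \<Rightarrow> bool" where
  "semisimple s m x \<longleftrightarrow>
     (\<forall>y. \<exists>W. fin_dim_stable s m x W \<and> y \<in> W) \<and>
     (\<forall>W. fin_dim_stable s m x W \<longrightarrow> diagonalisable_on s m x W)"

definition axis ::
  "('f::field \<Rightarrow> 'a::ab_group_add \<Rightarrow> 'a) \<Rightarrow> ('a \<Rightarrow> 'a \<Rightarrow> 'a)
    \<Rightarrow> 'f set \<Rightarrow> ('f \<Rightarrow> 'f \<Rightarrow> 'f set) \<Rightarrow> 'a \<Rightarrow> bool" where
  "axis s m Fs star a \<longleftrightarrow>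
     a \<noteq> 0 \<and> m a a = a \<and> semisimple s m a \<and> Spec s m a \<subseteq> Fs \<and>
     (\<forall>l\<in>Spec s m a. \<forall>u\<in>Spec s m a. \<forall>x\<in>eigenspace s m a l. \<forall>y\<in>eigenspace s m a u.
        m x y \<in> eigensum s m a (star l u))"

definition subalgebra ::
  "('f::field \<Rightarrow> 'a::ab_group_add \<Rightarrow> 'a) \<Rightarrow> ('a \<Rightarrow> 'a \<Rightarrow> 'a) \<Rightarrow> 'a set \<Rightarrow> bool" where
  "subalgebra s m S \<longleftrightarrow> module.subspace s S \<and> (\<forall>x\<in>S. \<forall>y\<in>S. m x y \<in> S)"

definition generates ::
  "('f::field \<Rightarrow> 'a::ab_group_add \<Rightarrow> 'a) \<Rightarrow> ('a \<Rightarrow> 'a \<Rightarrow> 'a) \<Rightarrow> 'a set \<Rightarrow> bool" where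
  "generates s m X \<longleftrightarrow> subalgebra s m hull X = UNIV"

definition axial_algebra ::
  "('f::field \<Rightarrow> 'a::ab_group_add \<Rightarrow> 'a) \<Rightarrow> ('a \<Rightarrow> 'a \<Rightarrow> 'a)
    \<Rightarrow> 'f set \<Rightarrow> ('f \<Rightarrow> 'f \<Rightarrow> 'f set) \<Rightarrow> 'a set \<Rightarrow> bool" where
  "axial_algebra s m Fs star X \<longleftrightarrow>
     comm_algebra s m \<and> finite X \<and> (\<forall>a\<in>X. axis s m Fs star a) \<and> generates s m X"

text \<open>
  Minimal sets of axes generating the algebra. Finiteness is not required: it is automatic as
  soon as the algebra is finitely generated.
\<close>

definition minimal_generating_axes ::
  "('f::field \<Rightarrow> 'a::ab_group_add \<Rightarrow> 'a) \<Rightarrow> ('a \<Rightarrow> 'a \<Rightarrow> 'a)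
    \<Rightarrow> 'f set \<Rightarrow> ('f \<Rightarrow> 'f \<Rightarrow> 'f set) \<Rightarrow> 'a set \<Rightarrow> bool" where
  "minimal_generating_axes s m Fs star X \<longleftrightarrow>
     (\<forall>a\<in>X. axis s m Fs star a) \<and> generates s m X \<and> (\<forall>X'. X' \<subset> X \<longrightarrow> \<not> generates s m X')"


section \<open>Central extensions and cocycles\<close>

text \<open>
  The central extension of \<open>(sA, mA)\<close> by \<open>\<theta>\<close> lives on \<open>'a \<times> 'v\<close>, with scalar multiplication
  \<open>module_prod.scale sA sV\<close>; the projection \<open>P\<close> is \<open>fst\<close>.
\<close>

definition ext_mult ::
  "('a \<Rightarrow> 'a \<Rightarrow> 'a) \<Rightarrow> ('a \<Rightarrow> 'a \<Rightarrow> 'v) \<Rightarrow> 'a \<times> 'v \<Rightarrow> 'a \<times> 'v \<Rightarrow> 'a \<times> 'v" where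
  "ext_mult m \<theta> p q = (m (fst p) (fst q), \<theta> (fst p) (fst q))"

definition ker_L :: "('a \<Rightarrow> 'a \<Rightarrow> 'a::zero) \<Rightarrow> 'a \<Rightarrow> 'a set" where
  "ker_L m x = {y. m x y = 0}"

definition perp :: "('a \<Rightarrow> 'a \<Rightarrow> 'v::zero) \<Rightarrow> 'a \<Rightarrow> 'a set" where
  "perp \<theta> x = {y. \<theta> x y = 0}"

text \<open>
  The class of \<open>\<theta>\<close> modulo the maps \<open>\<delta>f\<close>, as a coset.
\<close>

definition bil_class ::
  "('f::field \<Rightarrow> 'a::ab_group_add \<Rightarrow> 'a) \<Rightarrow> ('f \<Rightarrow> 'w::ab_group_add \<Rightarrow> 'w)
    \<Rightarrow> ('a \<Rightarrow> 'a \<Rightarrow> 'a) \<Rightarrow> ('a \<Rightarrow> 'a \<Rightarrow> 'w) \<Rightarrow> ('a \<Rightarrow> 'a \<Rightarrow> 'w) set" where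
  "bil_class sA sW m \<theta> =
     {\<phi>. \<exists>f. Vector_Spaces.linear sA sW f \<and> \<phi> = (\<lambda>x y. \<theta> x y + f (m x y))}"

text \<open>
  Linear independence of the family of classes of the components \<open>\<theta>\<^sub>e\<close>, \<open>e \<in> E\<close>, of \<open>\<theta>\<close> with
  respect to a basis \<open>E\<close> of \<open>V\<close>. Linear combinations of classes are formed on representatives.
\<close>

definition components_independent ::
  "('f::field \<Rightarrow> 'a::ab_group_add \<Rightarrow> 'a) \<Rightarrow> ('a \<Rightarrow> 'a \<Rightarrow> 'a)
    \<Rightarrow> ('f \<Rightarrow> 'v::ab_group_add \<Rightarrow> 'v) \<Rightarrow> ('a \<Rightarrow> 'a \<Rightarrow> 'v) \<Rightarrow> 'v set \<Rightarrow> bool" where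
  "components_independent sA m sV \<theta> E \<longleftrightarrow>
     (\<forall>S c. finite S \<and> S \<subseteq> E \<and>
        bil_class sA (*) m (\<lambda>x y. \<Sum>e\<in>S. c e * module.representation sV E (\<theta> x y) e)
          = bil_class sA (*) m (\<lambda>x y. 0)
        \<longrightarrow> (\<forall>e\<in>S. c e = 0))"

text \<open>
  In the second condition, \<open>m x y = \<Sum> z\<^sub>\<nu>\<close> is the decomposition of the product, with only finitely
  many \<open>z\<^sub>\<nu>\<close> nonzero; for an axis \<open>a\<close> it exists and is unique on \<open>star l u\<close>.
\<close>

definition cocycles ::
  "('f::field \<Rightarrow> 'a::ab_group_add \<Rightarrow> 'a) \<Rightarrow> ('a \<Rightarrow> 'a \<Rightarrow> 'a)
    \<Rightarrow> ('f \<Rightarrow> 'v::ab_group_add \<Rightarrow> 'v) \<Rightarrow> ('f \<Rightarrow> 'f \<Rightarrow> 'f set) \<Rightarrow> 'a set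
    \<Rightarrow> ('a \<Rightarrow> 'a \<Rightarrow> 'v) set" where
  "cocycles sA m sV star X =
     {\<theta>. bilinear_map sA sA sV \<theta> \<and> (\<forall>x y. \<theta> x y = \<theta> y x) \<and>
        (\<forall>a\<in>X.
           ker_L m a \<subseteq> perp \<theta> a \<and>
           (\<forall>l\<in>Spec sA m a. \<forall>u\<in>Spec sA m a. 0 \<notin> star l u \<longrightarrow>
             (\<forall>x\<in>eigenspace sA m a l. \<forall>y\<in>eigenspace sA m a u. \<forall>z.
                (\<forall>n\<in>star l u. z n \<in> eigenspace sA m a n) \<and>
                finite {n \<in> star l u. z n \<noteq> 0} \<and>
                m x y = (\<Sum>n\<in>{n \<in> star l u. z n \<noteq> 0}. z n)
                \<longrightarrow> \<theta> x y = (\<Sum>n\<in>{n \<in> star l u. z n \<noteq> 0}. sV (inverse n) (\<theta> a (z n))))))}"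


section \<open>Dependence on the basis\<close>

text \<open>
  If \<open>V\<close> is finite-dimensional, then independence of the components does not depend on the basis.
  In infinite dimension it does: independence with respect to one basis does not exclude a
  nonzero functional \<open>g\<close> on \<open>V\<close>, with infinitely many nonzero values on the basis, such that
  \<open>g \<circ> \<theta> = \<delta>f\<close>, and then the central extension is not generated by lifts of the axes. Independence
  with respect to every basis says exactly that no such \<open>g\<close> exists, since \<open>g\<close> can be made a
  coordinate function.
\<close>

lemma components_independent_change_basis:
  assumes V: "vector_space sV" and E: "basis sV E" "finite E" and E': "basis sV E'"
    and ind: "components_independent sA m sV \<theta> E"
  shows "components_independent sA m sV \<theta> E'"
  unfolding components_independent_def
proof (intro allI impI, elim conjE)
  interpret V: vector_space sV by fact
  fix S c
  let ?r = "V.representation E" and ?r' = "V.representation E'"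
  assume S: "finite S" "S \<subseteq> E'"
    and eq: "bil_class sA (*) m (\<lambda>x y. \<Sum>e\<in>S. c e * ?r' (\<theta> x y) e)
               = bil_class sA (*) m (\<lambda>x y. 0)"
  define g where "g v = (\<Sum>e\<in>S. c e * ?r' v e)" for v
  have ind': "V.independent E'" "\<And>v. v \<in> V.span E'" and indE: "V.independent E" "\<And>v. v \<in> V.span E"
    using E E' by (auto simp: basis_def)
  have g_sum: "g (\<Sum>e\<in>T. sV (k e) (h e)) = (\<Sum>e\<in>T. k e * g (h e))" if "finite T" for T k and h :: "'d \<Rightarrow> 'b"
    unfolding g_def using that ind'
    by (simp add: V.representation_sum V.representation_scale sum_distrib_left)
      (subst sum.swap, simp add: mult.left_commute)
  have g_E: "g v = (\<Sum>e\<in>E. g e * ?r v e)" for v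
    using g_sum[OF \<open>finite E\<close>, of "?r v" "\<lambda>e. e"]
      V.sum_representation_eq[OF indE(1) indE(2) \<open>finite E\<close> subset_refl]
    by (simp add: mult.commute)
  have "\<forall>e\<in>E. g e = 0"
    using ind[unfolded components_independent_def, rule_format, of E g] eq \<open>finite E\<close>
    by (simp add: g_E[symmetric] g_def[symmetric])
  then have g0: "g v = 0" for v
    by (simp add: g_E[of v])
  show "\<forall>e\<in>S. c e = 0"
  proof
    fix e assume "e \<in> S"
    then have "g e = (\<Sum>e'\<in>S. if e' = e then c e else 0)"
      unfolding g_def using S by (intro sum.cong) (auto simp: V.representation_basis[OF ind'(1)])
    then show "c e = 0"
      using g0[of e] S \<open>e \<in> S\<close> by simp
  qed
qed

end

theory Submission
  imports Defs
begin

text \<open>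
  Each axis \<open>a\<close> lifts to the idempotent \<open>(a, \<theta> a a)\<close>. For \<open>l \<noteq> 0\<close> an \<open>l\<close>-eigenvector \<open>y\<close> of \<open>a\<close> has
  the unique lift \<open>(y, \<theta> a y / l)\<close>, whereas \<open>V\<close> consists of \<open>0\<close>-eigenvectors and, for \<open>y\<close> in the
  kernel of \<open>L\<^sub>a\<close>, \<open>(y, 0)\<close> is killed by the square of the multiplication operator, hence by the
  operator itself if the lift is semisimple. The kernel condition thus amounts to semisimplicity
  of the lift, and the cocycle identity compares \<open>\<theta> x y\<close> with the lift of the decomposition of
  \<open>x y\<close>; it is void when \<open>0\<close> is among the admissible eigenvalues, since \<open>V\<close> absorbs the difference.
\<close>

section \<open>Eigenspace decompositions and semisimplicity\<close>

context comm_algebra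
begin

lemma mult_add_right: "m x (y + z) = m x y + m x z"
  and mult_scale_right: "m x (s c y) = s c (m x y)"
  and mult_add_left: "m (y + z) x = m y x + m z x"
  and mult_scale_left: "m (s c y) x = s c (m y x)"
  using bilinear_mult by (auto simp: bilinear_map_def Vector_Spaces.linear_iff)

sublocale mult: Vector_Spaces.linear s s "m x" for x
  using bilinear_mult by (simp add: bilinear_map_def)

lemma mult_zero_left: "m 0 x = 0"
  by (simp add: mult_commute[of 0] mult.zero)

lemma subspace_eigenspace: "subspace (eigenspace s m x l)"
  by (auto simp: subspace_def eigenspace_def mult.zero mult_add_right mult_scale_right
      scale_right_distrib mult.commute)

lemma subspace_eigensum: "subspace (eigensum s m x S)"
  by (simp add: eigensum_def)

lemma eigenspace_subset_eigensum: "l \<in> S \<Longrightarrow> eigenspace s m x l \<subseteq> eigensum s m x S"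
  unfolding eigensum_def by (meson UN_upper order_trans span_superset)

lemma eigenspace_nonzero_in_Spec: "y \<in> eigenspace s m x l \<Longrightarrow> y \<noteq> 0 \<Longrightarrow> l \<in> Spec s m x"
  by (auto simp: eigenspace_def Spec_def)

text \<open>Eigenspaces for scalars outside \<open>Spec\<close> are zero, so they add nothing to the
  sum.\<close>

lemma eigensum_restrict_Spec:
  assumes "Spec s m x \<subseteq> S"
  shows "eigensum s m x S = eigensum s m x UNIV"
proof -
  have "eigenspace s m x l \<subseteq> eigensum s m x S" for l
  proof
    fix y assume y: "y \<in> eigenspace s m x l"
    show "y \<in> eigensum s m x S"
    proof (cases "y = 0")
      case True
      then show ?thesis by (simp add: subspace_0 subspace_eigensum)
    next
      case False
      then show ?thesis
        using eigenspace_nonzero_in_Spec[OF y] assms y eigenspace_subset_eigensum by blast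
    qed
  qed
  then have "eigensum s m x UNIV \<subseteq> eigensum s m x S"
    unfolding eigensum_def[of _ _ _ UNIV] by (intro span_minimal subspace_eigensum) blast
  moreover have "eigensum s m x S \<subseteq> eigensum s m x UNIV"
    unfolding eigensum_def by (intro span_mono) blast
  ultimately show ?thesis by blast
qed

text \<open>Terms with the same eigenvalue are merged, so that each eigenvalue indexes one
  component. The values of \<open>z\<close> outside \<open>T\<close> also lie in their eigenspaces,
  so the family can be rescaled without side conditions.\<close>

lemma eigensum_decomposition:
  assumes "p \<in> eigensum s m x S"
  obtains z T where "finite T" "T \<subseteq> S" "\<And>n. z n \<in> eigenspace s m x n" "p = sum z T"
proof -
  have "\<exists>z T. finite T \<and> T \<subseteq> S \<and> (\<forall>n. z n \<in> eigenspace s m x n) \<and> p = sum z T"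
    using assms unfolding eigensum_def
  proof (induction rule: span_induct_alt)
    case base
    show ?case
      by (rule exI[of _ "\<lambda>_. 0"], rule exI[of _ "{}"])
        (simp add: subspace_0 subspace_eigenspace)
  next
    case (step c y p)
    then obtain k z T where k: "k \<in> S" "y \<in> eigenspace s m x k"
      and T: "finite T" "T \<subseteq> S" "\<And>n. z n \<in> eigenspace s m x n" "p = sum z T"
      by blast
    define z' where "z' n = (if n = k then s c y else 0) + (if n \<in> T then z n else 0)" for n
    have "z' n \<in> eigenspace s m x n" for n
      unfolding z'_def using k T subspace_eigenspace
      by (auto intro!: subspace_add subspace_scale subspace_0)
    moreover have "s c y + p = sum z' (insert k T)"
      using T by (simp add: z'_def sum.distrib sum.If_cases Int_absorb2 Int_insert_left
          subset_insertI sum.inter_restrict[symmetric] Int_commute)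
    ultimately show ?case
      using k T by (intro exI[of _ z'] exI[of _ "insert k T"]) auto
  qed
  then show thesis using that by blast
qed

text \<open>The operator L_x - k kills the component for k and multiplies the one for n by n - k,
  which is nonzero on the rest of the index set; induction on this set follows. The case W = {0} is
  the directness of the sum of eigenspaces.\<close>

lemma eigen_components_in_stable:
  assumes "finite T" "subspace W" "\<And>y. y \<in> W \<Longrightarrow> m x y \<in> W"
    and "\<And>n. z n \<in> eigenspace s m x n" "sum z T \<in> W" "n \<in> T"
  shows "z n \<in> W"
  using assms(1,4-)
proof (induction T arbitrary: z n rule: finite_induct)
  case empty
  then show ?case by simp
next
  case (insert k T)
  have eig: "m x (z n) = s n (z n)" for n
    using insert.prems(1)[of n] by (simp add: eigenspace_def)
  let ?u = "sum z (insert k T)"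
  have "m x ?u - s k ?u = (\<Sum>n\<in>T. s (n - k) (z n))"
    using insert.hyps
    by (simp add: mult.add mult.sum eig scale_right_distrib scale_sum_right
        scale_left_diff_distrib sum_subtractf)
  moreover have "m x ?u - s k ?u \<in> W"
    using insert.prems assms(2,3) by (intro subspace_diff subspace_scale) auto
  ultimately have *: "s (n - k) (z n) \<in> W" if "n \<in> T" for n
    using insert.IH[of "\<lambda>n. s (n - k) (z n)" n] that insert.prems(1)
      subspace_scale[OF subspace_eigenspace] by simp
  have T: "z n \<in> W" if "n \<in> T" for n
  proof -
    have "n - k \<noteq> 0" using that insert.hyps by auto
    then have "z n = s (inverse (n - k)) (s (n - k) (z n))" by simp
    then show ?thesis using *[OF that] assms(2) by (metis subspace_scale)
  qed
  have "z k = ?u - sum z T" using insert.hyps by simp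
  also have "\<dots> \<in> W"
    by (intro subspace_diff subspace_sum assms(2) insert.prems(2) T)
  finally show ?case using T insert.prems by auto
qed

text \<open>Since L_x - l kills \<open>p\<close>, directness makes n - l times each component
  vanish, and n - l is nonzero for every n in \<open>S\<close>.\<close>

lemma eigensum_inter_eigenspace:
  assumes "p \<in> eigensum s m x S" "p \<in> eigenspace s m x l" "l \<notin> S"
  shows "p = 0"
proof -
  obtain z T where T: "finite T" "T \<subseteq> S" "\<And>n. z n \<in> eigenspace s m x n" "p = sum z T"
    using eigensum_decomposition[OF assms(1)] by blast
  define z' where "z' n = s (n - l) (z n)" for n
  have "m x (z n) = s n (z n)" for n
    using T(3)[of n] by (simp add: eigenspace_def)
  then have "sum z' T = m x p - s l p"
    by (simp add: T(4) z'_def mult.sum scale_sum_right scale_left_diff_distrib sum_subtractf)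
  then have "sum z' T \<in> {0}"
    using assms(2) by (simp add: eigenspace_def)
  moreover have "z' n \<in> eigenspace s m x n" for n
    unfolding z'_def by (intro subspace_scale subspace_eigenspace T)
  ultimately have "z' n = 0" if "n \<in> T" for n
    using eigen_components_in_stable[of T "{0}" x z' n] T(1) that by (simp add: mult.zero)
  then have "z n = 0" if "n \<in> T" for n
    using that T(2) assms(3) by (auto simp: z'_def)
  then show ?thesis by (simp add: T(4))
qed

text \<open>This replaces the local definition by a global one that can be checked for lifts. In the
  backward direction, the components of \<open>y\<close> span a stable subspace containing
  \<open>y\<close>, and a stable \<open>W\<close> contains the components of its elements, hence is
  spanned by eigenvectors.\<close>

lemma semisimple_iff: "semisimple s m x \<longleftrightarrow> eigensum s m x UNIV = UNIV"
proof
  assume ss: "semisimple s m x"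
  have "y \<in> eigensum s m x UNIV" for y
  proof -
    obtain W where W: "fin_dim_stable s m x W" "y \<in> W"
      using ss by (auto simp: semisimple_def)
    then obtain B where B: "span B = W" "\<forall>b\<in>B. \<exists>l. m x b = s l b"
      using ss by (auto simp: semisimple_def diagonalisable_on_def)
    then have "W \<subseteq> eigensum s m x UNIV"
      unfolding eigensum_def B(1)[symmetric] by (intro span_mono) (auto simp: eigenspace_def)
    with W show ?thesis by blast
  qed
  then show "eigensum s m x UNIV = UNIV" by blast
next
  assume es: "eigensum s m x UNIV = UNIV"
  have "\<exists>W. fin_dim_stable s m x W \<and> y \<in> W" for y
  proof -
    obtain z T where T: "finite T" "\<And>n. z n \<in> eigenspace s m x n" "y = sum z T"
      using eigensum_decomposition[of y x UNIV] es by (metis UNIV_I)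
    have "m x v \<in> span (z ` T)" if "v \<in> span (z ` T)" for v
      using that
    proof (induction rule: span_induct_alt)
      case base
      then show ?case by (simp add: mult.zero span_zero)
    next
      case (step c b v)
      have "m x b \<in> span (z ` T)"
        using step.hyps T(2) by (auto simp: eigenspace_def span_base span_scale)
      then show ?case
        using step by (simp add: mult_add_right mult_scale_right span_add span_scale)
    qed
    then have "fin_dim_stable s m x (span (z ` T))"
      unfolding fin_dim_stable_def using T(1) by blast
    moreover have "y \<in> span (z ` T)"
      unfolding T(3) by (intro span_sum span_base) blast
    ultimately show ?thesis by blast
  qed
  moreover have "diagonalisable_on s m x W" if W: "fin_dim_stable s m x W" for W
  proof -
    have sub: "subspace W" and stable: "\<And>y. y \<in> W \<Longrightarrow> m x y \<in> W"
      using W by (auto simp: fin_dim_stable_def)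
    \<comment> \<open>An independent set chosen inside \<open>?V\<close> consists of eigenvectors
      from the outset, so only spanning remains.\<close>
    let ?V = "W \<inter> (\<Union>l. eigenspace s m x l)"
    obtain B where B: "B \<subseteq> ?V" "independent B" "?V \<subseteq> span B"
      using maximal_independent_subset by blast
    have "span B \<subseteq> W"
      using B sub by (intro span_minimal) auto
    moreover have "W \<subseteq> span B"
    proof
      fix y assume "y \<in> W"
      obtain z T where T: "finite T" "\<And>n. z n \<in> eigenspace s m x n" "y = sum z T"
        using eigensum_decomposition[of y x UNIV] es by (metis UNIV_I)
      have "z n \<in> W" if "n \<in> T" for n
        using eigen_components_in_stable[OF T(1) sub stable T(2) _ that] T(3) \<open>y \<in> W\<close> by simp
      then show "y \<in> span B"
        unfolding T(3) using T(2) B(3) by (intro span_sum) blast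
    qed
    ultimately show ?thesis
      unfolding diagonalisable_on_def using B by (intro exI[of _ B]) (auto simp: eigenspace_def)
  qed
  ultimately show "semisimple s m x" by (auto simp: semisimple_def)
qed

text \<open>The square of L_x multiplies the component for n by n * n, so by directness only the
  component for 0 can be nonzero, and L_x kills it.\<close>

lemma semisimple_ker_square:
  assumes "semisimple s m x" "m x (m x y) = 0"
  shows "m x y = 0"
proof -
  obtain z T where T: "finite T" "\<And>n. z n \<in> eigenspace s m x n" "y = sum z T"
    using eigensum_decomposition[of y x UNIV] assms(1) by (metis UNIV_I semisimple_iff)
  have eig: "m x (z n) = s n (z n)" for n
    using T(2)[of n] by (simp add: eigenspace_def)
  have "z n = 0" if "n \<in> T - {0}" for n
  proof -
    have "(\<Sum>n\<in>T. s (n * n) (z n)) \<in> {0}"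
      using assms(2) by (simp add: T(3) mult.sum mult_scale_right eig)
    moreover have "s (n * n) (z n) \<in> eigenspace s m x n" for n
      by (intro subspace_scale subspace_eigenspace T(2))
    ultimately have "s (n * n) (z n) \<in> {0}"
      using eigen_components_in_stable[OF T(1), of "{0}" x "\<lambda>n. s (n * n) (z n)" n] that
      by (simp add: mult.zero)
    then show ?thesis using that by simp
  qed
  then have "s n (z n) = 0" if "n \<in> T" for n
    using that by (cases "n = 0") auto
  then show ?thesis
    unfolding T(3) mult.sum eig by (intro sum.neutral) blast
qed

section \<open>Generating sets and their finiteness\<close>

lemma subalgebra_hull: "subalgebra s m (subalgebra s m hull X)"
  by (rule hull_in) (auto simp: subalgebra_def intro!: subspace_Inter)

text \<open>Each of the finitely many elements of \<open>X\<close> already lies in the subalgebra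
  generated by a finite subset of \<open>Y\<close>. The union of these subsets generates, so it
  equals \<open>Y\<close> by minimality.\<close>

lemma minimal_generating_axes_finite:
  assumes Y: "minimal_generating_axes s m Fs star Y" and X: "finite X" "generates s m X"
  shows "finite Y"
proof -
  let ?H = "\<lambda>F. subalgebra s m hull F"
  \<comment> \<open>The union of the subalgebras generated by finite subsets of \<open>Y\<close> is
    directed, hence a subalgebra; it contains \<open>Y\<close>.\<close>
  define U where "U = (\<Union>F\<in>{F. finite F \<and> F \<subseteq> Y}. ?H F)"
  have U_iff: "p \<in> U \<longleftrightarrow> (\<exists>F. (finite F \<and> F \<subseteq> Y) \<and> p \<in> ?H F)" for p
    by (simp add: U_def)
  have directed: "\<exists>F. finite F \<and> F \<subseteq> Y \<and> p \<in> ?H F \<and> q \<in> ?H F" if "p \<in> U" "q \<in> U" for p q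
  proof -
    from that obtain F G where F: "finite F \<and> F \<subseteq> Y" "p \<in> ?H F" and G: "finite G \<and> G \<subseteq> Y" "q \<in> ?H G"
      using U_iff by metis
    moreover have "?H F \<subseteq> ?H (F \<union> G)" "?H G \<subseteq> ?H (F \<union> G)"
      by (intro hull_mono; simp)+
    ultimately show ?thesis
      by (intro exI[of _ "F \<union> G"]) auto
  qed
  have H: "subspace (?H F)" "\<And>p q. p \<in> ?H F \<Longrightarrow> q \<in> ?H F \<Longrightarrow> m p q \<in> ?H F" for F
    using subalgebra_hull by (auto simp: subalgebra_def)
  have inU: "p \<in> U" if "finite F" "F \<subseteq> Y" "p \<in> ?H F" for p F
    using that U_iff by metis
  have "subspace U"
    unfolding subspace_def
  proof (intro conjI ballI allI)
    show "0 \<in> U" using inU[of "{}"] subspace_0[OF H(1)] by simp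
    show "p + q \<in> U" if "p \<in> U" "q \<in> U" for p q
      using directed[OF that] inU subspace_add[OF H(1)] by blast
    show "s c p \<in> U" if "p \<in> U" for c p
      using directed[OF that that] inU subspace_scale[OF H(1)] by blast
  qed
  moreover have "m p q \<in> U" if "p \<in> U" "q \<in> U" for p q
    using directed[OF that] inU H(2) by blast
  ultimately have "subalgebra s m U" by (auto simp: subalgebra_def)
  moreover have "y \<in> U" if "y \<in> Y" for y
    using that inU[of "{y}" y] hull_inc[of y "{y}"] by simp
  ultimately have "?H Y \<subseteq> U" by (intro hull_minimal subsetI)
  then have "x \<in> U" for x
    using Y by (auto simp: minimal_generating_axes_def generates_def)
  then obtain F where F: "\<And>x. finite (F x)" "\<And>x. F x \<subseteq> Y" "\<And>x. x \<in> ?H (F x)"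
    using U_iff by metis
  let ?G = "\<Union>x\<in>X. F x"
  have "X \<subseteq> ?H ?G"
    using F(3) hull_mono[of "F x" ?G "subalgebra s m" for x] by (meson UN_upper subset_iff)
  then have "generates s m ?G"
    using X(2) hull_minimal[of X "?H ?G" "subalgebra s m"] subalgebra_hull
    by (auto simp: generates_def)
  moreover have "?G \<subseteq> Y" using F(2) by blast
  ultimately have "?G = Y"
    using Y unfolding minimal_generating_axes_def psubset_eq by blast
  moreover have "finite ?G" using F(1) X(1) by (rule finite_UN_I[rotated])
  ultimately show ?thesis by simp
qed

lemma generates_superset: "generates s m X \<Longrightarrow> X \<subseteq> Y \<Longrightarrow> generates s m Y"
  unfolding generates_def using hull_mono by (metis top.extremum_uniqueI)

end

section \<open>The central extension and generation by lifts\<close>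

locale central_extension =
  A: comm_algebra sA mA + V: vector_space sV
  for sA :: "'f::field \<Rightarrow> 'a::ab_group_add \<Rightarrow> 'a" and mA :: "'a \<Rightarrow> 'a \<Rightarrow> 'a"
    and sV :: "'f \<Rightarrow> 'v::ab_group_add \<Rightarrow> 'v" +
  fixes \<theta> :: "'a \<Rightarrow> 'a \<Rightarrow> 'v"
  assumes bilinear_cocycle: "bilinear_map sA sA sV \<theta>"
    and cocycle_commute: "\<theta> x y = \<theta> y x"
begin

abbreviation sE where "sE \<equiv> module_prod.scale sA sV"
abbreviation mE where "mE \<equiv> ext_mult mA \<theta>"

sublocale prod: vector_space_prod sA sV ..

sublocale coc: Vector_Spaces.linear sA sV "\<theta> x" for x
  using bilinear_cocycle by (simp add: bilinear_map_def)

lemma cocycle_left: "\<theta> (x + y) z = \<theta> x z + \<theta> y z" "\<theta> (sA c x) z = sV c (\<theta> x z)" "\<theta> 0 z = 0"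
  by (simp_all add: cocycle_commute[of _ z] coc.add coc.scale coc.zero)

sublocale E: comm_algebra sE mE
proof
  show "bilinear_map sE sE sE mE"
    using prod.p.vector_space_axioms
    by (auto simp: bilinear_map_def Vector_Spaces.linear_iff ext_mult_def prod.scale_def
        A.mult_add_right A.mult_scale_right A.mult_add_left A.mult_scale_left coc.add coc.scale cocycle_left)
  show "mE x y = mE y x" for x y
    by (simp add: ext_mult_def A.mult_commute[of "fst x"] cocycle_commute[of "fst x"])
qed

text \<open>
  If the subalgebra \<open>B\<close> generated by the lifts met \<open>V\<close> in a proper subspace \<open>W\<close>, then a coordinate
  functional \<open>g\<close> vanishing on \<open>W\<close> would induce \<open>f\<close> on \<open>A\<close> by \<open>f x = g v\<close> for \<open>(x, v) \<in> B\<close>, so that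
  \<open>g \<circ> \<theta> = \<delta>f\<close>.
\<close>

lemma generates_lift:
  assumes Z: "generates sA mA Z"
    and ind: "\<And>E. basis sV E \<Longrightarrow> components_independent sA mA sV \<theta> E"
  shows "generates sE mE ((\<lambda>a. (a, h a)) ` Z)"
proof -
  define B where "B = subalgebra sE mE hull ((\<lambda>a. (a, h a)) ` Z)"
  have B: "prod.p.subspace B" "\<And>p q. p \<in> B \<Longrightarrow> q \<in> B \<Longrightarrow> mE p q \<in> B"
    using E.subalgebra_hull unfolding B_def subalgebra_def by auto
  have B_add: "(x + y, v + w) \<in> B" if "(x, v) \<in> B" "(y, w) \<in> B" for x y v w
    using prod.p.subspace_add[OF B(1) that] by simp
  have B_diff: "(x - y, v - w) \<in> B" if "(x, v) \<in> B" "(y, w) \<in> B" for x y v w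
    using prod.p.subspace_diff[OF B(1) that] by simp
  have B_scale: "(sA c x, sV c v) \<in> B" if "(x, v) \<in> B" for c x v
    using prod.p.subspace_scale[OF B(1) that, of c] by (simp add: prod.scale_def)
  have B_mult: "(mA x y, \<theta> x y) \<in> B" if "(x, v) \<in> B" "(y, w) \<in> B" for x y v w
    using B(2)[OF that] by (simp add: ext_mult_def)
  have B_zero: "(0, 0) \<in> B"
    using prod.p.subspace_0[OF B(1)] by (simp add: zero_prod_def)
  have "subalgebra sA mA (fst ` B)"
    unfolding subalgebra_def A.subspace_def fst_eq_Domain
    using B_add B_scale B_mult B_zero by blast
  moreover have "Z \<subseteq> fst ` B"
    unfolding B_def using hull_subset[of "(\<lambda>a. (a, h a)) ` Z" "subalgebra sE mE"] by force
  ultimately have "subalgebra sA mA hull Z \<subseteq> fst ` B"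
    by (intro hull_minimal)
  then have "\<forall>x. \<exists>v. (x, v) \<in> B"
    using Z by (force simp: generates_def)
  \<comment> \<open>An arbitrary section of the projection on \<open>B\<close>, not assumed linear;
    any two choices differ by values in the subspace \<open>W\<close> below.\<close>
  then obtain \<sigma> where \<sigma>: "\<And>x. (x, \<sigma> x) \<in> B" by metis
  define W where "W = {v. (0, v) \<in> B}"
  have W: "V.subspace W"
    unfolding W_def V.subspace_def
    using B_add[of 0 _ 0] B_scale[of 0] B_zero by auto
  have "W = UNIV"
  proof (rule ccontr)
    assume neq: "W \<noteq> UNIV"
    obtain C where C: "C \<subseteq> W" "V.independent C" "W \<subseteq> V.span C"
      using V.maximal_independent_subset by blast
    \<comment> \<open>This basis of \<open>V\<close> extends a basis of \<open>W\<close>. It depends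
      on \<open>W\<close>, so independence of the components is used for a basis not known in
      advance.\<close>
    define D where "D = V.extend_basis C"
    have D: "C \<subseteq> D" "V.independent D" "V.span D = UNIV"
      unfolding D_def using C(2)
      by (simp_all add: V.extend_basis_superset V.independent_extend_basis)
    have spanD: "v \<in> V.span D" for v by (simp add: D(3))
    have "\<not> D \<subseteq> C"
      using neq D(3) V.span_mono[of D C] V.span_minimal[OF C(1) W] by blast
    then obtain e where e: "e \<in> D" "e \<notin> C" by blast
    define g where "g v = V.representation D v e" for v
    have g_lin: "g (v + w) = g v + g w" "g (v - w) = g v - g w" "g (sV c v) = c * g v" for v w c
      using spanD by (simp_all add: g_def V.representation_add V.representation_diff
          V.representation_scale D(2))
    have g_W: "g v = 0" if "v \<in> W" for v
    proof -
      have "v \<in> V.span C" using that C(3) by blast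
      then show ?thesis
      proof (induction rule: V.span_induct_alt)
        case base
        show ?case using g_lin(2)[of 0 0] by simp
      next
        case (step c b w)
        then have "g b = 0"
          using D(1,2) e by (auto simp: g_def V.representation_basis)
        with step show ?case by (simp add: g_lin)
      qed
    qed
    \<comment> \<open>Two lifts of \<open>x\<close> to \<open>B\<close> differ by an element of
      \<open>W\<close>, where \<open>g\<close> vanishes. Hence \<open>f\<close> is independent of
      the chosen section, and linear although \<open>\<sigma>\<close> need not be.\<close>
    define f where "f x = g (\<sigma> x)" for x
    have f_eq: "f x = g v" if "(x, v) \<in> B" for x v
    proof -
      have "\<sigma> x - v \<in> W" using B_diff[OF \<sigma>[of x] that] by (simp add: W_def)
      then show ?thesis using g_W g_lin(2)[of "\<sigma> x" v] by (simp add: f_def)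
    qed
    have f_lin: "f (x + y) = f x + f y" "f (sA c x) = c * f x" for x y c
      using f_eq[OF B_add[OF \<sigma> \<sigma>]] f_eq[OF B_scale[OF \<sigma>]]
      by (simp_all add: g_lin f_def)
    have \<delta>f: "g (\<theta> x y) = f (mA x y)" for x y
      using f_eq[OF B_mult[OF \<sigma> \<sigma>]] by simp
    have mult_vs: "vector_space ((*) :: 'f \<Rightarrow> 'f \<Rightarrow> 'f)"
      by unfold_locales (simp_all add: algebra_simps)
    have lin: "Vector_Spaces.linear sA (*) k \<longleftrightarrow>
        (\<forall>x y. k (x + y) = k x + k y) \<and> (\<forall>c x. k (sA c x) = c * k x)" for k :: "'a \<Rightarrow> 'f"
      using A.vector_space_axioms mult_vs by (simp add: Vector_Spaces.linear_iff)
    have "bil_class sA (*) mA (\<lambda>x y. g (\<theta> x y)) = bil_class sA (*) mA (\<lambda>x y. 0)"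
    proof (intro equalityI subsetI)
      fix \<phi> assume "\<phi> \<in> bil_class sA (*) mA (\<lambda>x y. g (\<theta> x y))"
      then obtain k where "Vector_Spaces.linear sA (*) k" "\<phi> = (\<lambda>x y. g (\<theta> x y) + k (mA x y))"
        by (auto simp: bil_class_def)
      then show "\<phi> \<in> bil_class sA (*) mA (\<lambda>x y. 0)"
        unfolding bil_class_def
        by (intro CollectI exI[of _ "\<lambda>x. f x + k x"]) (simp add: lin \<delta>f f_lin algebra_simps)
    next
      fix \<phi> assume "\<phi> \<in> bil_class sA (*) mA (\<lambda>x y. 0)"
      then obtain k where "Vector_Spaces.linear sA (*) k" "\<phi> = (\<lambda>x y. k (mA x y))"
        by (auto simp: bil_class_def)
      then show "\<phi> \<in> bil_class sA (*) mA (\<lambda>x y. g (\<theta> x y))"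
        unfolding bil_class_def
        by (intro CollectI exI[of _ "\<lambda>x. k x - f x"]) (simp add: lin \<delta>f f_lin algebra_simps)
    qed
    moreover have "components_independent sA mA sV \<theta> D"
      using ind D by (auto simp: basis_def)
    \<comment> \<open>Independence is applied to the single component at \<open>e\<close> with
      coefficient 1, whose class has just been shown to be trivial.\<close>
    ultimately have "(1 :: 'f) = 0"
      unfolding components_independent_def g_def
      using e(1) by (elim allE[of _ "{e}"] allE[of _ "\<lambda>_. 1"]) simp
    then show False by simp
  qed
  have "(x, v) \<in> B" for x v
  proof -
    have "(0, v - \<sigma> x) \<in> B" using \<open>W = UNIV\<close> by (auto simp: W_def)
    from B_add[OF \<sigma> this, of x] show ?thesis by simp
  qed
  then show ?thesis unfolding generates_def B_def[symmetric] by auto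
qed

section \<open>Eigenvectors of a lift\<close>

context
  fixes a :: 'a and v :: 'v
begin

text \<open>For \<open>y\<close> in the kernel, multiplication by the lift sends
  \<open>(y, 0)\<close> to the vertical vector \<open>(0, \<theta> a y)\<close>, which it then
  kills. The component \<open>v\<close> is arbitrary because \<open>ext_mult\<close> ignores
  it.\<close>

lemma lift_ker_perp:
  assumes "semisimple sE mE (a, v)"
  shows "ker_L mA a \<subseteq> perp \<theta> a"
proof
  fix y assume "y \<in> ker_L mA a"
  then have y: "mE (a, v) (y, 0) = (0, \<theta> a y)"
    by (simp add: ext_mult_def ker_L_def)
  have "mE (a, v) (0, \<theta> a y) = 0"
    by (simp add: ext_mult_def A.mult.zero coc.zero zero_prod_def)
  then show "y \<in> perp \<theta> a"
    using E.semisimple_ker_square[OF assms, of "(y, 0)"] y by (simp add: perp_def zero_prod_def)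
qed

text \<open>The condition on \<open>w\<close> determines it when \<open>l\<close> is nonzero; for
  \<open>l = 0\<close> it leaves \<open>w\<close> free and forces
  \<open>\<theta> a y = 0\<close>.\<close>

lemma eigenspace_lift_iff:
  "(y, w) \<in> eigenspace sE mE (a, v) l \<longleftrightarrow> y \<in> eigenspace sA mA a l \<and> \<theta> a y = sV l w"
  by (simp add: eigenspace_def ext_mult_def prod.scale_def)

lemma vertical_in_eigenspace_lift: "(0, w) \<in> eigenspace sE mE (a, v) 0"
  by (simp add: eigenspace_lift_iff A.subspace_0 A.subspace_eigenspace coc.zero)

text \<open>An eigenvector with \<open>y = 0\<close> is vertical and killed by the multiplication,
  so its eigenvalue is 0; otherwise \<open>y\<close> is an eigenvector of \<open>a\<close>.\<close>

lemma Spec_lift: "Spec sE mE (a, v) \<subseteq> insert 0 (Spec sA mA a)"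
proof
  fix l assume "l \<in> Spec sE mE (a, v)"
  then obtain y w where "(y, w) \<noteq> 0" "(y, w) \<in> eigenspace sE mE (a, v) l"
    by (auto simp: Spec_def eigenspace_def)
  then show "l \<in> insert 0 (Spec sA mA a)"
    by (cases "y = 0")
      (auto simp: eigenspace_lift_iff coc.zero zero_prod_def intro: A.eigenspace_nonzero_in_Spec)
qed

context
  assumes ker: "ker_L mA a \<subseteq> perp \<theta> a"
begin

text \<open>For \<open>l = 0\<close> the junk value \<open>inverse 0 = 0\<close> gives an eigenvector because of \<open>ker\<close>.\<close>

lemma lift_in_eigenspace:
  assumes "y \<in> eigenspace sA mA a l"
  shows "(y, sV (inverse l) (\<theta> a y)) \<in> eigenspace sE mE (a, v) l"
  using assms ker unfolding eigenspace_lift_iff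
  by (cases "l = 0") (auto simp: eigenspace_def ker_L_def perp_def)

lemma Spec_subset_Spec_lift: "Spec sA mA a \<subseteq> Spec sE mE (a, v)"
proof
  fix l assume "l \<in> Spec sA mA a"
  then obtain y where "y \<noteq> 0" "y \<in> eigenspace sA mA a l"
    by (auto simp: Spec_def eigenspace_def)
  then show "l \<in> Spec sE mE (a, v)"
    using E.eigenspace_nonzero_in_Spec[OF lift_in_eigenspace] by (auto simp: zero_prod_def)
qed

lemma sum_lift_in_eigensum:
  assumes "\<And>n. n \<in> T \<Longrightarrow> z n \<in> eigenspace sA mA a n" "T \<subseteq> S"
  shows "(sum z T, \<Sum>n\<in>T. sV (inverse n) (\<theta> a (z n))) \<in> eigensum sE mE (a, v) S"
  unfolding sum_prod[symmetric] using assms lift_in_eigenspace E.eigenspace_subset_eigensum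
  by (intro prod.p.subspace_sum E.subspace_eigensum) blast

text \<open>Lifting the eigencomponents of \<open>y\<close> reaches some \<open>(y, w')\<close> in
  the sum of eigenspaces; the error \<open>(0, w - w')\<close> is a 0-eigenvector.\<close>

lemma semisimple_lift:
  assumes "semisimple sA mA a"
  shows "semisimple sE mE (a, v)"
  unfolding E.semisimple_iff
proof -
  have "(y, w) \<in> eigensum sE mE (a, v) UNIV" for y w
  proof -
    obtain z T where T: "finite T" "\<And>n. z n \<in> eigenspace sA mA a n" "y = sum z T"
      using A.eigensum_decomposition[of y a UNIV] assms by (metis UNIV_I A.semisimple_iff)
    define w' where "w' = (\<Sum>n\<in>T. sV (inverse n) (\<theta> a (z n)))"
    have "(y, w') + (0, w - w') \<in> eigensum sE mE (a, v) UNIV"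
      using sum_lift_in_eigensum[of T z UNIV] T
        subsetD[OF E.eigenspace_subset_eigensum vertical_in_eigenspace_lift]
      by (intro prod.p.subspace_add E.subspace_eigensum) (auto simp: w'_def)
    then show ?thesis by simp
  qed
  then show "eigensum sE mE (a, v) UNIV = UNIV" by auto
qed

end

end

section \<open>Lifts of axes and their fusion laws\<close>

text \<open>For the constant law with value \<open>Fs \<union> {0}\<close> the fusion rule is void,
  since the eigenspaces for this set already sum to the whole extension.\<close>

lemma lift_axis_total:
  assumes "axis sA mA Fs star a" "ker_L mA a \<subseteq> perp \<theta> a"
  shows "axis sE mE (Fs \<union> {0}) (\<lambda>_ _. Fs \<union> {0}) (a, \<theta> a a)"
proof -
  let ?a = "(a, \<theta> a a)"
  have ss: "semisimple sE mE ?a"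
    using assms semisimple_lift by (simp add: axis_def)
  have spec: "Spec sE mE ?a \<subseteq> Fs \<union> {0}"
    using assms(1) Spec_lift[of a "\<theta> a a"] by (auto simp: axis_def)
  have "eigensum sE mE ?a (Fs \<union> {0}) = UNIV"
    using E.eigensum_restrict_Spec[OF spec] ss by (simp add: E.semisimple_iff)
  then show ?thesis
    using assms(1) ss spec by (auto simp: axis_def ext_mult_def zero_prod_def)
qed

text \<open>The second condition of \<open>cocycles\<close> at a single axis, split off because the
  kernel condition corresponds to semisimplicity alone.\<close>

definition fusion_condition where
  "fusion_condition star a \<longleftrightarrow>
     (\<forall>l\<in>Spec sA mA a. \<forall>u\<in>Spec sA mA a. 0 \<notin> star l u \<longrightarrow>
       (\<forall>x\<in>eigenspace sA mA a l. \<forall>y\<in>eigenspace sA mA a u. \<forall>z.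
          (\<forall>n\<in>star l u. z n \<in> eigenspace sA mA a n) \<and>
          finite {n \<in> star l u. z n \<noteq> 0} \<and>
          mA x y = (\<Sum>n\<in>{n \<in> star l u. z n \<noteq> 0}. z n)
          \<longrightarrow> \<theta> x y = (\<Sum>n\<in>{n \<in> star l u. z n \<noteq> 0}. sV (inverse n) (\<theta> a (z n)))))"

lemma cocycles_iff:
  "\<theta> \<in> cocycles sA mA sV star Z \<longleftrightarrow>
     (\<forall>a\<in>Z. ker_L mA a \<subseteq> perp \<theta> a \<and> fusion_condition star a)"
  using bilinear_cocycle cocycle_commute by (auto simp: cocycles_def fusion_condition_def)

text \<open>A product of lifted eigenvectors and the lift of the decomposition of
  \<open>mA x y\<close> differ by a vertical vector. Such a vector lies in the sum over
  \<open>star l u\<close> exactly when it is zero or 0 belongs to \<open>star l u\<close>.\<close>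

lemma lift_axis_zero_ext_iff:
  assumes ax: "axis sA mA Fs star a"
  shows "axis sE mE (Fs \<union> {0}) (zero_ext Fs star) (a, \<theta> a a) \<longleftrightarrow>
    ker_L mA a \<subseteq> perp \<theta> a \<and> fusion_condition star a"
proof
  let ?a = "(a, \<theta> a a)"
  assume lift: "axis sE mE (Fs \<union> {0}) (zero_ext Fs star) ?a"
  then have ker: "ker_L mA a \<subseteq> perp \<theta> a"
    using lift_ker_perp[of a "\<theta> a a"] by (simp add: axis_def)
  moreover have "fusion_condition star a"
    unfolding fusion_condition_def
  proof (intro ballI impI allI, elim conjE)
    fix l u x y and z :: "'f \<Rightarrow> 'a"
    let ?T = "{n \<in> star l u. z n \<noteq> 0}"
    assume l: "l \<in> Spec sA mA a" and u: "u \<in> Spec sA mA a" and 0: "0 \<notin> star l u"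
      and x: "x \<in> eigenspace sA mA a l" and y: "y \<in> eigenspace sA mA a u"
      and z: "\<forall>n\<in>star l u. z n \<in> eigenspace sA mA a n" and xy: "mA x y = sum z ?T"
    let ?w = "\<Sum>n\<in>?T. sV (inverse n) (\<theta> a (z n))"
    have "l \<in> Spec sE mE ?a" "u \<in> Spec sE mE ?a"
      using l u Spec_subset_Spec_lift[OF ker] by auto
    moreover have "zero_ext Fs star l u = star l u"
      using l u ax by (auto simp: zero_ext_def axis_def)
    ultimately have "mE (x, sV (inverse l) (\<theta> a x)) (y, sV (inverse u) (\<theta> a y))
        \<in> eigensum sE mE ?a (star l u)"
      using lift lift_in_eigenspace[OF ker x] lift_in_eigenspace[OF ker y] unfolding axis_def
      by metis
    moreover have "(sum z ?T, ?w) \<in> eigensum sE mE ?a (star l u)"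
      using z by (intro sum_lift_in_eigensum ker) auto
    \<comment> \<open>The difference is vertical, hence a 0-eigenvector, while it also lies in a sum
      of eigenspaces for nonzero eigenvalues; so it is zero.\<close>
    ultimately have "(mA x y, \<theta> x y) - (sum z ?T, ?w) \<in> eigensum sE mE ?a (star l u)"
      by (intro prod.p.subspace_diff E.subspace_eigensum) (simp_all add: ext_mult_def)
    then have "(0 :: 'a, \<theta> x y - ?w) = 0"
      using E.eigensum_inter_eigenspace[OF _ vertical_in_eigenspace_lift 0] by (simp add: xy)
    then show "\<theta> x y = ?w" by (simp add: zero_prod_def)
  qed
  ultimately show "ker_L mA a \<subseteq> perp \<theta> a \<and> fusion_condition star a" ..
next
  let ?a = "(a, \<theta> a a)"
  assume "ker_L mA a \<subseteq> perp \<theta> a \<and> fusion_condition star a"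
  then have ker: "ker_L mA a \<subseteq> perp \<theta> a" and fus: "fusion_condition star a" by auto
  have "mE (x, v) (y, w) \<in> eigensum sE mE ?a (zero_ext Fs star l u)"
    if x: "(x, v) \<in> eigenspace sE mE ?a l" and y: "(y, w) \<in> eigenspace sE mE ?a u" for l u x v y w
  proof (cases "x = 0 \<or> y = 0")
    \<comment> \<open>A vertical factor annihilates everything. This settles the pairs where the
      eigenvalue 0 comes only from \<open>V\<close> and may lie outside the spectrum of
      \<open>a\<close>, whatever value \<open>zero_ext\<close> gives them.\<close>
    case True
    then have "mE (x, v) (y, w) = 0"
      by (auto simp: ext_mult_def zero_prod_def A.mult_zero_left A.mult.zero coc.zero cocycle_left)
    then show ?thesis
      by (simp add: prod.p.subspace_0 E.subspace_eigensum)
  next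
    case False
    have x': "x \<in> eigenspace sA mA a l" and y': "y \<in> eigenspace sA mA a u"
      using x y by (auto simp: eigenspace_lift_iff)
    then have l: "l \<in> Spec sA mA a" and u: "u \<in> Spec sA mA a"
      using A.eigenspace_nonzero_in_Spec False by auto
    then have ext: "zero_ext Fs star l u = star l u"
      using ax by (auto simp: zero_ext_def axis_def)
    have "mA x y \<in> eigensum sA mA a (star l u)"
      using ax l u x' y' by (auto simp: axis_def)
    then obtain z\<^sub>0 T where T: "finite T" "T \<subseteq> star l u" "\<And>n. z\<^sub>0 n \<in> eigenspace sA mA a n"
        "mA x y = sum z\<^sub>0 T"
      using A.eigensum_decomposition by metis
    \<comment> \<open>Cutting off outside \<open>T\<close> makes the support within
      \<open>star l u\<close> finite, as \<open>fusion_condition\<close> demands.\<close>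
    define z where "z n = (if n \<in> T then z\<^sub>0 n else 0)" for n
    let ?T = "{n \<in> star l u. z n \<noteq> 0}"
    have z: "z n \<in> eigenspace sA mA a n" for n
      by (simp add: z_def T(3) A.subspace_0 A.subspace_eigenspace)
    have fin: "finite ?T"
      by (rule finite_subset[OF _ T(1)]) (auto simp: z_def)
    have xy: "mA x y = sum z ?T"
      unfolding T(4) using T(1,2) by (intro sum.mono_neutral_cong_right) (auto simp: z_def)
    define w' where "w' = (\<Sum>n\<in>?T. sV (inverse n) (\<theta> a (z n)))"
    have lift: "(sum z ?T, w') \<in> eigensum sE mE ?a (star l u)"
      unfolding w'_def using z by (intro sum_lift_in_eigensum ker) auto
    have "(0, \<theta> x y - w') \<in> eigensum sE mE ?a (star l u)"
    proof (cases "0 \<in> star l u")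
      case True
      then show ?thesis
        using vertical_in_eigenspace_lift E.eigenspace_subset_eigensum by blast
    next
      case False
      then have "\<theta> x y = w'"
        using fus l u x' y' z fin xy unfolding fusion_condition_def w'_def by blast
      then show ?thesis
        using prod.p.subspace_0[OF E.subspace_eigensum] by (simp add: zero_prod_def)
    qed
    with lift have "(sum z ?T, w') + (0, \<theta> x y - w') \<in> eigensum sE mE ?a (star l u)"
      by (intro prod.p.subspace_add E.subspace_eigensum)
    then show ?thesis
      by (simp add: ext_mult_def xy ext)
  qed
  then show "axis sE mE (Fs \<union> {0}) (zero_ext Fs star) ?a"
    using lift_axis_total[OF ax ker] unfolding axis_def by auto
qed

text \<open>Independence makes the lifts generate by \<open>generates_lift\<close>, so being axial
  reduces to a condition on each lifted axis. The largest law on \<open>Fs \<union> {0}\<close> is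
  the witness for existence.\<close>

lemma axial_lift_iff:
  assumes law: "fusion_law Fs star"
    and ind: "\<And>E. basis sV E \<Longrightarrow> components_independent sA mA sV \<theta> E"
    and Z: "finite Z" "\<And>a. a \<in> Z \<Longrightarrow> axis sA mA Fs star a" "generates sA mA Z"
  defines "L \<equiv> (\<lambda>a. (a, \<theta> a a)) ` Z"
  shows "(\<exists>odot. fusion_law (Fs \<union> {0}) odot \<and> fusion_contained Fs star (Fs \<union> {0}) odot \<and>
            axial_algebra sE mE (Fs \<union> {0}) odot L)
          \<longleftrightarrow> (\<forall>a\<in>Z. ker_L mA a \<subseteq> perp \<theta> a)" (is ?some)
    and "axial_algebra sE mE (Fs \<union> {0}) (zero_ext Fs star) L
          \<longleftrightarrow> \<theta> \<in> cocycles sA mA sV star Z" (is ?zero_ext)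
proof -
  have axial: "axial_algebra sE mE (Fs \<union> {0}) odot L
      \<longleftrightarrow> (\<forall>a\<in>Z. axis sE mE (Fs \<union> {0}) odot (a, \<theta> a a))" for odot
    unfolding axial_algebra_def L_def
    using generates_lift[OF Z(3) ind] Z(1) E.comm_algebra_axioms by simp
  show ?zero_ext
    unfolding axial cocycles_iff using lift_axis_zero_ext_iff Z(2) by blast
  show ?some
  proof
    assume "\<forall>a\<in>Z. ker_L mA a \<subseteq> perp \<theta> a"
    then have "axial_algebra sE mE (Fs \<union> {0}) (\<lambda>_ _. Fs \<union> {0}) L"
      unfolding axial using lift_axis_total Z(2) by blast
    moreover have "fusion_law (Fs \<union> {0}) (\<lambda>_ _. Fs \<union> {0})"
      by (simp add: fusion_law_def)
    moreover have "fusion_contained Fs star (Fs \<union> {0}) (\<lambda>_ _. Fs \<union> {0})"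
      using law by (auto simp: fusion_contained_def fusion_law_def)
    ultimately show "\<exists>odot. fusion_law (Fs \<union> {0}) odot \<and>
        fusion_contained Fs star (Fs \<union> {0}) odot \<and> axial_algebra sE mE (Fs \<union> {0}) odot L"
      by blast
  next
    assume "\<exists>odot. fusion_law (Fs \<union> {0}) odot \<and>
        fusion_contained Fs star (Fs \<union> {0}) odot \<and> axial_algebra sE mE (Fs \<union> {0}) odot L"
    then show "\<forall>a\<in>Z. ker_L mA a \<subseteq> perp \<theta> a"
      unfolding axial axis_def using lift_ker_perp by blast
  qed
qed

end

theorem theorem2p12:
  fixes sA :: "'f::field \<Rightarrow> 'a::ab_group_add \<Rightarrow> 'a"
    and mA :: "'a \<Rightarrow> 'a \<Rightarrow> 'a"
    and sV :: "'f \<Rightarrow> 'v::ab_group_add \<Rightarrow> 'v"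
    and Fs :: "'f set"
    and star :: "'f \<Rightarrow> 'f \<Rightarrow> 'f set"
    and X :: "'a set"
    and \<theta> :: "'a \<Rightarrow> 'a \<Rightarrow> 'v"
  defines "sE \<equiv> module_prod.scale sA sV"
    and "mE \<equiv> ext_mult mA \<theta>"
  assumes "fusion_law Fs star"
    and "axial_algebra sA mA Fs star X"
    and "vector_space sV"
    and "bilinear_map sA sA sV \<theta>"
    and "\<And>x y. \<theta> x y = \<theta> y x"
    and "\<And>E. basis sV E \<Longrightarrow> components_independent sA mA sV \<theta> E"
  shows
    "(\<forall>Xi. minimal_generating_axes sA mA Fs star Xi \<and> (\<forall>a\<in>Xi. \<theta> a a = 0) \<longrightarrow>
        ((\<exists>odot. fusion_law (Fs \<union> {0}) odot \<and>
            fusion_contained Fs star (Fs \<union> {0}) odot \<and>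
            axial_algebra sE mE (Fs \<union> {0}) odot ((\<lambda>a. (a, 0)) ` Xi))
          \<longleftrightarrow> (\<forall>a\<in>Xi. ker_L mA a \<subseteq> perp \<theta> a)) \<and>
        (axial_algebra sE mE (Fs \<union> {0}) (zero_ext Fs star) ((\<lambda>a. (a, 0)) ` Xi)
          \<longleftrightarrow> \<theta> \<in> cocycles sA mA sV star Xi))
     \<and>
     (\<forall>Y'. Y' \<subseteq> (\<lambda>a. (a, \<theta> a a)) ` X \<and>
          (\<exists>Xi. minimal_generating_axes sA mA Fs star Xi \<and> Xi \<subseteq> fst ` Y') \<longrightarrow>
        ((\<exists>odot. fusion_law (Fs \<union> {0}) odot \<and>
            fusion_contained Fs star (Fs \<union> {0}) odot \<and>
            axial_algebra sE mE (Fs \<union> {0}) odot Y')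
          \<longleftrightarrow> (\<forall>a\<in>fst ` Y'. ker_L mA a \<subseteq> perp \<theta> a)) \<and>
        (axial_algebra sE mE (Fs \<union> {0}) (zero_ext Fs star) Y'
          \<longleftrightarrow> \<theta> \<in> cocycles sA mA sV star (fst ` Y')))"
proof -
  interpret comm_algebra sA mA
    using assms(4) by (simp add: axial_algebra_def)
  interpret central_extension sA mA sV \<theta>
    using comm_algebra_axioms assms(5-7)
    by (intro central_extension.intro central_extension_axioms.intro)
  note iff = axial_lift_iff[OF assms(3,8), folded sE_def mE_def]
  have X: "finite X" "generates sA mA X" "\<And>a. a \<in> X \<Longrightarrow> axis sA mA Fs star a"
    using assms(4) by (auto simp: axial_algebra_def)
  show ?thesis
  proof (intro conjI allI impI; elim conjE exE)
    fix Xi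
    assume Xi: "minimal_generating_axes sA mA Fs star Xi" and "\<forall>a\<in>Xi. \<theta> a a = 0"
    \<comment> \<open>Normalisation identifies the copy of \<open>Xi\<close> in the extension with
      the set of its idempotent lifts.\<close>
    then have lift: "(\<lambda>a. (a, 0)) ` Xi = (\<lambda>a. (a, \<theta> a a)) ` Xi"
      by (intro image_cong) auto
    have gen: "finite Xi" "\<And>a. a \<in> Xi \<Longrightarrow> axis sA mA Fs star a" "generates sA mA Xi"
      using Xi minimal_generating_axes_finite[OF Xi X(1,2)]
      by (auto simp: minimal_generating_axes_def)
    show "(\<exists>odot. fusion_law (Fs \<union> {0}) odot \<and> fusion_contained Fs star (Fs \<union> {0}) odot \<and>
            axial_algebra sE mE (Fs \<union> {0}) odot ((\<lambda>a. (a, 0)) ` Xi))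
          \<longleftrightarrow> (\<forall>a\<in>Xi. ker_L mA a \<subseteq> perp \<theta> a)"
      unfolding lift by (rule iff(1)[OF _ gen])
    show "axial_algebra sE mE (Fs \<union> {0}) (zero_ext Fs star) ((\<lambda>a. (a, 0)) ` Xi)
          \<longleftrightarrow> \<theta> \<in> cocycles sA mA sV star Xi"
      unfolding lift by (rule iff(2)[OF _ gen])
  next
    fix Y' Xi
    assume Y': "Y' \<subseteq> (\<lambda>a. (a, \<theta> a a)) ` X"
      and Xi: "minimal_generating_axes sA mA Fs star Xi" "Xi \<subseteq> fst ` Y'"
    let ?Z = "fst ` Y'"
    \<comment> \<open>An element of \<open>Y'\<close> is determined by its first component, so
      \<open>Y'\<close> is recovered from its projection.\<close>
    have lift: "(\<lambda>a. (a, \<theta> a a)) ` ?Z = Y'"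
      using Y' by (force simp: image_iff)
    have sub: "?Z \<subseteq> X" using Y' by auto
    have "generates sA mA ?Z"
      using generates_superset[OF _ Xi(2)] Xi(1) by (simp add: minimal_generating_axes_def)
    then have gen: "finite ?Z" "\<And>a. a \<in> ?Z \<Longrightarrow> axis sA mA Fs star a" "generates sA mA ?Z"
      using finite_subset[OF sub X(1)] sub X(3) by (blast intro: subsetD)+
    show "(\<exists>odot. fusion_law (Fs \<union> {0}) odot \<and> fusion_contained Fs star (Fs \<union> {0}) odot \<and>
            axial_algebra sE mE (Fs \<union> {0}) odot Y')
          \<longleftrightarrow> (\<forall>a\<in>?Z. ker_L mA a \<subseteq> perp \<theta> a)"
      by (rule iff(1)[OF _ gen, unfolded lift])
    show "axial_algebra sE mE (Fs \<union> {0}) (zero_ext Fs star) Y'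
          \<longleftrightarrow> \<theta> \<in> cocycles sA mA sV star ?Z"
      by (rule iff(2)[OF _ gen, unfolded lift])
  qed
qed

end
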